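(* Let $\mu$ be a probability measure and $\omega\ge 1$ a weight. (1) Let $F$ be a continuous function such that $\sup_{0<r<1}|rF(r)|<\infty$, $F(1)=0$ and $\lim_{x\to+\infty}F(x)=+\infty$. If $\mu$ satisfies a defective weighted $F$-Sobolev inequality with constants $C_1,C_2$, i.e. for all smooth bounded $f$ with $\mu(f^2)=1$, $$\int f^2F(f^2)\,d\mu\le C_1\int\Gamma(f)\,\omega\,d\mu+C_2,$$ then there exist $c_1,c_2$ such that for all smooth bounded $f$ and all $s>0$, $$\int f^2\,d\mu\le s\int\Gamma(f)\,\omega\,d\mu+c_1\,F^{-1}\big(c_2(1+1/s)\big)\,\mu(|f|)^2,$$ where $F^{-1}(s)=\inf\{r\ge 0:\ F(r)\ge s\}$. (2) If $\mu$ satisfies a Super weighted Poincaré inequality, i.e. there is a non-increasing function $\beta_\omega$ such that for all $s>0$ and all smooth bounded $f$, $$\int f^2\,d\mu\le s\int\Gamma(f)\,\omega\,d\mu+\beta_\omega(s)\,\mu(|f|)^2,$$ then $\mu$ satisfies a defective weighted $F$-Sobolev inequality (that is, for some constants $C_1,C_2$, $\int f^2F(f^2)\,d\mu\le C_1\int\Gamma(f)\,\omega\,d\mu+C_2$ for all smooth bounded $f$ with $\mu(f^2)=1$) with $$F(r)=\frac{c_1(\epsilon)}{r}\int_0^r\xi(\epsilon t)\,dt-c_2(\epsilon)$$ for all $0<\epsilon<1$, where $c_1(\epsilon)$ and $c_2(\epsilon)$ are some constants and $$\xi(t)=\sup_{r>0}\left(\frac1r-\frac{\beta_\omega(r)}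{rt}\right).$$
   Context: $\mu$ is a probability measure on a Polish space $E$, symmetric for a diffusion semigroup with generator $L$. "Smooth bounded" functions are the elements of an algebra $\mathcal A$ of bounded uniformly continuous functions containing the constants, contained in the domain of $L$ (and dense in it for the graph norm). The carré du champ $\Gamma$ is defined by $L(fg)=fLg+gLf+2\Gamma(f,g)$, $\Gamma(f)=\Gamma(f,f)$; it is a derivation in each component and satisfies the chain rule $\Gamma(\Psi(f),\Phi(g))=\Psi'(f)\Phi'(g)\Gamma(f,g)$. (For $E=\mathbb{R}^n$, $\mu(dx)=p(x)dx$, $L=\Delta+\nabla\log p\cdot\nabla$, one has $\Gamma(f)=|\nabla f|^2$.) Notation: $\mu(g)=\int g\,d\mu$.
   Formalization: Part (1) additionally assumes that max(a,F) is non-decreasing on (0,∞) for some real a; for merely continuous F it fails, e.g. F(r)=1/r−1 for r<1 and log r for r≥1, where F^{-1}=0 on (0,∞) and f=1 violates the conclusion. *)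

theory Defs
  imports "HOL-Probability.Probability"
begin

section \<open>Symmetric Markov semigroups and their generators\<close>

definition square_integrable :: "'a measure \<Rightarrow> ('a \<Rightarrow> real) \<Rightarrow> bool" where
  "square_integrable M f \<longleftrightarrow> f \<in> borel_measurable M \<and> integrable M (\<lambda>x. (f x)\<^sup>2)"

text \<open>The squared norm of \<open>L\<^sup>2(M)\<close>, with values in \<open>[0, \<infinity>]\<close>.\<close>

definition L2_sq :: "'a measure \<Rightarrow> ('a \<Rightarrow> real) \<Rightarrow> ennreal" where
  "L2_sq M f = (\<integral>\<^sup>+x. ennreal ((f x)\<^sup>2) \<partial>M)"

definition semigroup_op :: "(real \<Rightarrow> 'a \<Rightarrow> 'a measure) \<Rightarrow> real \<Rightarrow> ('a \<Rightarrow> real) \<Rightarrow> 'a \<Rightarrow> real" where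
  "semigroup_op P t f x = (\<integral>y. f y \<partial>(P t x))"

locale symmetric_markov_semigroup = prob_space \<mu>
  for \<mu> :: "'a::polish_space measure" +
  fixes P :: "real \<Rightarrow> 'a \<Rightarrow> 'a measure"
  assumes sets_mu: "sets \<mu> = sets borel"
    and kernel: "0 \<le> t \<Longrightarrow> P t \<in> borel \<rightarrow>\<^sub>M prob_algebra borel"
    and semigroup_zero: "P 0 x = return borel x"
    and semigroup_add: "0 \<le> s \<Longrightarrow> 0 \<le> t \<Longrightarrow> P (s + t) x = P s x \<bind> P t"
    and symmetric:
      "\<lbrakk>0 \<le> t; f \<in> borel_measurable borel; bounded (range f);
        g \<in> borel_measurable borel; bounded (range g)\<rbrakk>
       \<Longrightarrow> (\<integral>x. f x * semigroup_op P t g x \<partial>\<mu>) = (\<integral>x. semigroup_op P t f x * g x \<partial>\<mu>)"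
    and strongly_continuous:
      "square_integrable \<mu> f
       \<Longrightarrow> ((\<lambda>t. L2_sq \<mu> (\<lambda>x. semigroup_op P t f x - f x)) \<longlongrightarrow> 0) (at_right 0)"

text \<open>\<open>f\<close> is in the domain of the \<open>L\<^sup>2(\<mu>)\<close>-generator and \<open>g\<close> is a version of \<open>L f\<close>.\<close>

definition has_generator ::
  "'a measure \<Rightarrow> (real \<Rightarrow> 'a \<Rightarrow> 'a measure) \<Rightarrow> ('a \<Rightarrow> real) \<Rightarrow> ('a \<Rightarrow> real) \<Rightarrow> bool" where
  "has_generator \<mu> P f g \<longleftrightarrow>
     square_integrable \<mu> f \<and> square_integrable \<mu> g \<and>
     ((\<lambda>t. L2_sq \<mu> (\<lambda>x. (semigroup_op P t f x - f x) / t - g x)) \<longlongrightarrow> 0) (at_right 0)"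

definition generator_domain ::
  "'a measure \<Rightarrow> (real \<Rightarrow> 'a \<Rightarrow> 'a measure) \<Rightarrow> ('a \<Rightarrow> real) set" where
  "generator_domain \<mu> P = {f. \<exists>g. has_generator \<mu> P f g}"

text \<open>\<open>L f\<close> is determined only up to \<open>\<mu>\<close>-null sets; an arbitrary version is chosen. Every
  statement below about \<open>L\<close> or \<open>\<Gamma>\<close> is invariant under changing the version.\<close>

definition generator ::
  "'a measure \<Rightarrow> (real \<Rightarrow> 'a \<Rightarrow> 'a measure) \<Rightarrow> ('a \<Rightarrow> real) \<Rightarrow> ('a \<Rightarrow> real)" where
  "generator \<mu> P f = (SOME g. has_generator \<mu> P f g)"

text \<open>\<open>\<Gamma>(f, g)\<close>, from \<open>L (f g) = f L g + g L f + 2 \<Gamma>(f, g)\<close>.\<close>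

definition carre_du_champ ::
  "'a measure \<Rightarrow> (real \<Rightarrow> 'a \<Rightarrow> 'a measure) \<Rightarrow> ('a \<Rightarrow> real) \<Rightarrow> ('a \<Rightarrow> real) \<Rightarrow> 'a \<Rightarrow> real" where
  "carre_du_champ \<mu> P f g x =
     (generator \<mu> P (\<lambda>y. f y * g y) x - f x * generator \<mu> P g x - g x * generator \<mu> P f x) / 2"

section \<open>Diffusions with a core algebra\<close>

definition smooth_real :: "(real \<Rightarrow> real) \<Rightarrow> bool" where
  "smooth_real \<Psi> \<longleftrightarrow> (\<forall>n x. (deriv ^^ n) \<Psi> field_differentiable at x)"

text \<open>For the chain rule to be meaningful, \<open>\<A>\<close> is required to be stable under composition with
  \<open>C\<^sup>\<infinity>\<close> functions of one real variable.\<close>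

locale symmetric_diffusion = symmetric_markov_semigroup \<mu> P
  for \<mu> :: "'a::polish_space measure" and P :: "real \<Rightarrow> 'a \<Rightarrow> 'a measure" +
  fixes \<A> :: "('a \<Rightarrow> real) set"
  assumes core_uniformly_continuous: "f \<in> \<A> \<Longrightarrow> uniformly_continuous_on UNIV f"
    and core_bounded: "f \<in> \<A> \<Longrightarrow> bounded (range f)"
    and core_const: "(\<lambda>_. c) \<in> \<A>"
    and core_add: "f \<in> \<A> \<Longrightarrow> g \<in> \<A> \<Longrightarrow> (\<lambda>x. f x + g x) \<in> \<A>"
    and core_mult: "f \<in> \<A> \<Longrightarrow> g \<in> \<A> \<Longrightarrow> (\<lambda>x. f x * g x) \<in> \<A>"
    and core_domain: "\<A> \<subseteq> generator_domain \<mu> P"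
    and core_dense:
      "\<lbrakk>f \<in> generator_domain \<mu> P; 0 < e\<rbrakk>
       \<Longrightarrow> \<exists>g\<in>\<A>. L2_sq \<mu> (\<lambda>x. f x - g x)
                 + L2_sq \<mu> (\<lambda>x. generator \<mu> P f x - generator \<mu> P g x) < e"
    and derivation:
      "\<lbrakk>f \<in> \<A>; g \<in> \<A>; h \<in> \<A>\<rbrakk>
       \<Longrightarrow> AE x in \<mu>. carre_du_champ \<mu> P (\<lambda>y. f y * g y) h x =
             f x * carre_du_champ \<mu> P g h x + g x * carre_du_champ \<mu> P f h x"
    and core_smooth: "f \<in> \<A> \<Longrightarrow> smooth_real \<Psi> \<Longrightarrow> (\<lambda>x. \<Psi> (f x)) \<in> \<A>"
    and chain_rule:
      "\<lbrakk>f \<in> \<A>; g \<in> \<A>; smooth_real \<Psi>; smooth_real \<Phi>\<rbrakk>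
       \<Longrightarrow> AE x in \<mu>. carre_du_champ \<mu> P (\<lambda>y. \<Psi> (f y)) (\<lambda>y. \<Phi> (g y)) x =
             deriv \<Psi> (f x) * deriv \<Phi> (g x) * carre_du_champ \<mu> P f g x"

section \<open>The functional inequalities\<close>

text \<open>The integral of an extended-real function whose positive or negative part has finite
  integral.\<close>

definition ext_integral :: "'a measure \<Rightarrow> ('a \<Rightarrow> ereal) \<Rightarrow> ereal" where
  "ext_integral M g =
     enn2ereal (\<integral>\<^sup>+x. e2ennreal (g x) \<partial>M) - enn2ereal (\<integral>\<^sup>+x. e2ennreal (- g x) \<partial>M)"

text \<open>\<open>\<integral> \<Gamma>(f) \<omega> d\<mu>\<close>, which may be infinite because \<open>\<omega>\<close> may be unbounded. Since \<open>P\<close> is Markov,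
  \<open>\<Gamma>(f) \<ge> 0\<close> almost everywhere, so nothing is truncated.\<close>

definition weighted_energy ::
  "'a measure \<Rightarrow> (real \<Rightarrow> 'a \<Rightarrow> 'a measure) \<Rightarrow> ('a \<Rightarrow> real) \<Rightarrow> ('a \<Rightarrow> real) \<Rightarrow> ereal" where
  "weighted_energy \<mu> P \<omega> f = enn2ereal (\<integral>\<^sup>+x. ennreal (carre_du_champ \<mu> P f f x * \<omega> x) \<partial>\<mu>)"

text \<open>Only the values of \<open>F\<close> on \<open>(0, \<infinity>)\<close> matter: where \<open>f = 0\<close> the integrand is \<open>0\<close>, also if
  \<open>F 0\<close> is infinite.\<close>

definition defective_weighted_F_Sobolev ::
  "'a measure \<Rightarrow> (real \<Rightarrow> 'a \<Rightarrow> 'a measure) \<Rightarrow> ('a \<Rightarrow> real) set \<Rightarrow> ('a \<Rightarrow> real) \<Rightarrow>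
   (real \<Rightarrow> ereal) \<Rightarrow> real \<Rightarrow> real \<Rightarrow> bool" where
  "defective_weighted_F_Sobolev \<mu> P \<A> \<omega> F C\<^sub>1 C\<^sub>2 \<longleftrightarrow>
     (\<forall>f\<in>\<A>. (\<integral>x. (f x)\<^sup>2 \<partial>\<mu>) = 1 \<longrightarrow>
        ext_integral \<mu> (\<lambda>x. ereal ((f x)\<^sup>2) * F ((f x)\<^sup>2))
          \<le> ereal C\<^sub>1 * weighted_energy \<mu> P \<omega> f + ereal C\<^sub>2)"

definition weighted_super_Poincare ::
  "'a measure \<Rightarrow> (real \<Rightarrow> 'a \<Rightarrow> 'a measure) \<Rightarrow> ('a \<Rightarrow> real) set \<Rightarrow> ('a \<Rightarrow> real) \<Rightarrow>
   (real \<Rightarrow> real) \<Rightarrow> bool" where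
  "weighted_super_Poincare \<mu> P \<A> \<omega> \<beta> \<longleftrightarrow>
     (\<forall>f\<in>\<A>. \<forall>s>0.
        ereal (\<integral>x. (f x)\<^sup>2 \<partial>\<mu>)
          \<le> ereal s * weighted_energy \<mu> P \<omega> f + ereal (\<beta> s * (\<integral>x. \<bar>f x\<bar> \<partial>\<mu>)\<^sup>2))"

text \<open>For \<open>F\<close> given only on \<open>(0, \<infinity>)\<close>, such as \<open>ln\<close>, the value \<open>F 0\<close> is arbitrary; it does not affect
  \<open>gen_inverse F s\<close> for \<open>s > F 0\<close>.\<close>

definition gen_inverse :: "(real \<Rightarrow> real) \<Rightarrow> real \<Rightarrow> real" where
  "gen_inverse F s = Inf {r. 0 \<le> r \<and> s \<le> F r}"

text \<open>\<open>F\<close> is non-decreasing on \<open>(0, \<infinity>)\<close>, except possibly below some level \<open>a\<close>; equivalently,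
  for \<open>s > a\<close> the set \<open>{r > 0. s \<le> F r}\<close> is upward closed, so that \<open>gen_inverse F\<close> really inverts
  \<open>F\<close> at high levels. Every non-decreasing function qualifies. Without such a condition the
  implication from \<open>F\<close>-Sobolev to super Poincare fails: \<open>F r = 1 / r - 1\<close> for \<open>r < 1\<close> and
  \<open>F r = ln r\<close> for \<open>r \<ge> 1\<close> has \<open>gen_inverse F s = 0\<close> for all \<open>s > 0\<close>, while every measure with
  a defective log-Sobolev inequality satisfies the defective \<open>F\<close>-Sobolev inequality.\<close>

definition increasing_at_high_levels :: "(real \<Rightarrow> real) \<Rightarrow> bool" where
  "increasing_at_high_levels F \<longleftrightarrow> (\<exists>a. mono_on {0<..} (\<lambda>r. max a (F r)))"

text \<open>\<open>\<xi>\<close> can be infinite, namely when \<open>\<beta>\<close> is bounded near \<open>0\<close>. If \<open>\<beta>\<close> is non-increasing, then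
  \<open>\<xi> t \<ge> 0\<close> for \<open>t > 0\<close> (let \<open>r \<rightarrow> \<infinity>\<close>).\<close>

definition xi :: "(real \<Rightarrow> real) \<Rightarrow> real \<Rightarrow> ereal" where
  "xi \<beta> t = (SUP r\<in>{0<..}. ereal (1 / r - \<beta> r / (r * t)))"

definition F_of_beta :: "(real \<Rightarrow> real) \<Rightarrow> real \<Rightarrow> real \<Rightarrow> real \<Rightarrow> real \<Rightarrow> ereal" where
  "F_of_beta \<beta> \<epsilon> c\<^sub>1 c\<^sub>2 r =
     ereal (c\<^sub>1 / r) * ext_integral (restrict_space lborel {0<..r}) (\<lambda>t. xi \<beta> (\<epsilon> * t)) - ereal c\<^sub>2"

end

theory Submission imports Defs begin

text \<open>
  Part (1): at height \<open>R = F\<^sup>-\<^sup>1(K)\<close> one has \<open>f\<^sup>2 \<le> \<surd>R \<bar>f\<bar> + (f\<^sup>2 F(f\<^sup>2) + A + B f\<^sup>2) / K\<close> pointwise, where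
  \<open>- A - B r\<close> is a lower bound of \<open>r F(r)\<close>. Integrating and taking \<open>K\<close> a large multiple of
  \<open>1 + 1 / s\<close> absorbs the defect.

  Part (2): instead of dyadic truncations, which do not belong to the core, use the smooth cut-offs
  \<open>f\<^sub>t = \<phi>(f\<^sup>2 / t - 1)\<close>, \<open>\<phi>(x) = exp (- 1 / x)\<close> for \<open>x > 0\<close>, at every level \<open>t > 0\<close>. The super
  Poincare inequality and \<open>\<mu>(\<bar>f\<^sub>t\<bar>)\<^sup>2 \<le> \<mu>(f\<^sub>t\<^sup>2) / t\<close> give \<open>\<xi>(t) \<mu>(f\<^sub>t\<^sup>2) \<le> \<integral> \<Gamma>(f\<^sub>t) \<omega> d\<mu>\<close>, while
  \<open>\<Gamma>(f\<^sub>t) \<le> 64 \<Gamma>(f) / f\<^sup>2\<close> on \<open>{f\<^sup>2 > t}\<close> and \<open>\<Gamma>(f\<^sub>t) = 0\<close> elsewhere. Hence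
  the energies integrate over \<open>t\<close> to at most \<open>64 \<integral> \<Gamma>(f) \<omega> d\<mu>\<close>; as \<open>f\<^bsub>\<epsilon>t\<^esub>\<close> is bounded below on \<open>{f\<^sup>2 \<ge> t}\<close>, Tonelli's theorem finishes the proof.
\<close>

section \<open>Smooth cut-off functions\<close>

text \<open>By induction every iterated derivative stays in the class, so no closed form of the n-th
  derivative enters.\<close>

lemma smooth_real_closed_set:
  assumes deriv: "\<And>f. f \<in> S \<Longrightarrow> \<exists>g\<in>S. \<forall>x. (f has_real_derivative g x) (at x)" and f: "f \<in> S"
  shows "smooth_real f"
proof -
  have "(deriv ^^ n) f \<in> S" for n
  proof (induction n)
    case (Suc n)
    then obtain g where "g \<in> S" "\<And>x. ((deriv ^^ n) f has_real_derivative g x) (at x)"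
      using deriv by blast
    then show ?case
      using DERIV_imp_deriv by (metis (no_types) comp_apply ext funpow.simps(2))
  qed (use f in simp)
  then show ?thesis
    using deriv unfolding smooth_real_def field_differentiable_def by blast
qed

lemma smooth_real_poly: "smooth_real (poly p)"
  by (rule smooth_real_closed_set[where S = "range poly"]) (use poly_DERIV in blast)+

text \<open>A family closed under differentiation that contains \<open>exp (- 1 / x)\<close>, extended by \<open>0\<close>.\<close>

definition flat_poly :: "real poly \<Rightarrow> real \<Rightarrow> real" where
  "flat_poly p x = (if 0 < x then poly p (1 / x) * exp (- (1 / x)) else 0)"

lemma poly_times_exp_tendsto_0: "((\<lambda>y. poly p y * exp (- y)) \<longlongrightarrow> (0::real)) at_top"
proof -
  have "((\<lambda>y. \<Sum>i\<le>degree p. coeff p i * (y ^ i / exp y)) \<longlongrightarrow> (\<Sum>i\<le>degree p. coeff p i * 0)) at_top"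
    by (intro tendsto_intros tendsto_power_div_exp_0)
  then show ?thesis
    by (simp add: poly_altdef exp_minus field_simps sum_distrib_left sum_divide_distrib)
qed

text \<open>Away from 0 this is the chain rule with y = 1 / x: differentiating p(y) exp(-y) in x
  gives y^2 (p - p')(y) exp(-y), and \<open>monom 1 2\<close> is y^2. At 0 the decay of exp(-y)
  beats every polynomial in y.\<close>

lemma flat_poly_has_derivative:
  "(flat_poly p has_real_derivative flat_poly (monom 1 2 * (p - pderiv p)) x) (at x)"
proof -
  consider "0 < x" | "x < 0" | "x = 0" by linarith
  then show ?thesis
  proof cases
    case 1
    have "((\<lambda>x. poly p (1 / x) * exp (- (1 / x))) has_real_derivative
        flat_poly (monom 1 2 * (p - pderiv p)) x) (at x)"
      using 1 by (auto intro!: derivative_eq_intros DERIV_chain2[OF poly_DERIV]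
        simp: flat_poly_def poly_monom field_simps power2_eq_square)
    then show ?thesis
      by (rule has_field_derivative_transform_within_open[where S = "{0<..}"])
        (use 1 in \<open>auto simp: flat_poly_def\<close>)
  next
    case 2
    have "((\<lambda>_. 0) has_real_derivative 0) (at x)" by simp
    then have "(flat_poly p has_real_derivative 0) (at x)"
      by (rule has_field_derivative_transform_within_open[where S = "{..<0}"])
        (use 2 in \<open>auto simp: flat_poly_def\<close>)
    then show ?thesis using 2 by (simp add: flat_poly_def)
  next
    case 3
    have "((\<lambda>y. (flat_poly p y - flat_poly p 0) / (y - 0)) \<longlongrightarrow> 0) (at 0)"
    proof (rule filterlim_split_at_real)
      show "((\<lambda>y. (flat_poly p y - flat_poly p 0) / (y - 0)) \<longlongrightarrow> 0) (at_left 0)"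
        by (rule tendsto_eventually)
          (auto simp: flat_poly_def eventually_at_filter)
      \<comment> \<open>With y = 1 / x the difference quotient at 0 is y p(y) exp(-y), and
        \<open>pCons 0 p\<close> is y p(y).\<close>
      have "((\<lambda>y. poly (pCons 0 p) (inverse y) * exp (- inverse y)) \<longlongrightarrow> (0::real)) (at_right 0)"
        by (rule filterlim_compose[OF poly_times_exp_tendsto_0 filterlim_inverse_at_top_right])
      then show "((\<lambda>y. (flat_poly p y - flat_poly p 0) / (y - 0)) \<longlongrightarrow> 0) (at_right 0)"
        by (rule Lim_transform_eventually)
          (auto simp: flat_poly_def eventually_at_filter field_simps)
    qed
    then have "(flat_poly p has_real_derivative 0) (at 0)"
      by (simp add: has_field_derivative_iff)
    then show ?thesis using 3 by (simp add: flat_poly_def)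
  qed
qed

lemma smooth_real_flat_poly: "smooth_real (flat_poly p)"
  by (rule smooth_real_closed_set[where S = "range flat_poly"])
    (use flat_poly_has_derivative in blast)+

abbreviation flat_exp :: "real \<Rightarrow> real" where
  "flat_exp \<equiv> flat_poly 1"

lemma flat_exp_bounds: "0 \<le> flat_exp x" "flat_exp x \<le> 1" "0 < x \<Longrightarrow> 0 < flat_exp x"
  by (auto simp: flat_poly_def)

lemma flat_exp_mono: "x \<le> y \<Longrightarrow> flat_exp x \<le> flat_exp y"
  by (auto simp: flat_poly_def field_simps)

lemma deriv_flat_exp:
  "deriv flat_exp x = (if 0 < x then exp (- (1 / x)) / x\<^sup>2 else 0)"
  using DERIV_imp_deriv[OF flat_poly_has_derivative[of 1 x]]
  by (simp add: flat_poly_def poly_monom pderiv_1 power_one_over)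

text \<open>The weight \<open>x + 1\<close> is what the cut-off at level t requires: for x = y^2 / t
  - 1 it equals y^2 / t, which turns the bound into control of the gradient of the cut-off by that
  of f divided by f.\<close>

lemma deriv_flat_exp_le:
  assumes "0 < x"
  shows "0 \<le> deriv flat_exp x" "deriv flat_exp x * (x + 1) \<le> 4"
proof -
  show "0 \<le> deriv flat_exp x" by (simp add: deriv_flat_exp)
  have "(1 / x)\<^sup>2 / 2 \<le> exp (1 / x)"
    using exp_lower_Taylor_quadratic[of "1 / x"] assms zero_less_divide_1_iff[of x] by linarith
  then have "exp (- (1 / x)) / x\<^sup>2 \<le> 2"
    using assms by (simp add: exp_minus field_simps)
  moreover have "exp (- (1 / x)) / x\<^sup>2 \<le> 1 / x\<^sup>2"
    using assms by (intro divide_right_mono) auto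
  \<comment> \<open>The first bound serves x \<le> 1, the second x > 1, where x \<le> x^2.\<close>
  ultimately have *: "deriv flat_exp x \<le> 2" "deriv flat_exp x \<le> 1 / x\<^sup>2"
    using assms by (auto simp: deriv_flat_exp)
  show "deriv flat_exp x * (x + 1) \<le> 4"
  proof (cases "x \<le> 1")
    case True
    have "deriv flat_exp x * (x + 1) \<le> 2 * 2"
      using * True assms by (intro mult_mono) auto
    then show ?thesis by simp
  next
    case False
    then have "x \<le> x\<^sup>2" by (simp add: power2_eq_square)
    have "deriv flat_exp x * (x + 1) \<le> 1 / x\<^sup>2 * (x + 1)"
      using * False by (intro mult_right_mono) auto
    also have "\<dots> \<le> 4"
      using \<open>x \<le> x\<^sup>2\<close> False by (simp add: field_simps)
    finally show ?thesis .
  qed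
qed

section \<open>Measurability and extended integrals\<close>

text \<open>Superlevel sets of a monotone function are intervals. This yields measurability for
  \<open>xi\<close>, a supremum over uncountably many r.\<close>

lemma borel_measurable_mono_linorder:
  fixes g :: "real \<Rightarrow> 'b::{linorder_topology, second_countable_topology}"
  assumes "mono g"
  shows "g \<in> borel_measurable borel"
proof (rule borel_measurableI_greater)
  fix y
  have "is_interval {x. y < g x}"
    using assms unfolding is_interval_1 mono_def by (auto intro: less_le_trans)
  then show "{x \<in> space borel. y < g x} \<in> sets borel"
    by (simp add: real_interval_borel_measurable)
qed

lemma ext_integral_real:
  assumes "integrable M h"
  shows "ext_integral M (\<lambda>x. ereal (h x)) = ereal (\<integral>x. h x \<partial>M)"
proof -
  have fin: "(\<integral>\<^sup>+x. ennreal (h x) \<partial>M) \<noteq> \<infinity>" "(\<integral>\<^sup>+x. ennreal (- h x) \<partial>M) \<noteq> \<infinity>"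
    using assms by (auto simp: real_integrable_def)
  then obtain a b where ab: "0 \<le> a" "(\<integral>\<^sup>+x. ennreal (h x) \<partial>M) = ennreal a"
      "0 \<le> b" "(\<integral>\<^sup>+x. ennreal (- h x) \<partial>M) = ennreal b"
    by (metis ennreal_cases infinity_ennreal_def)
  then show ?thesis
    unfolding ext_integral_def real_lebesgue_integral_def[OF assms] by simp
qed

lemma weighted_energy_nonneg: "0 \<le> weighted_energy \<mu> P \<omega> f"
  by (simp add: weighted_energy_def)

section \<open>Core functions and their weighted energy\<close>

context symmetric_diffusion
begin

lemma core_measurable: "f \<in> \<A> \<Longrightarrow> f \<in> borel_measurable \<mu>"
  using borel_measurable_continuous_onI[OF uniformly_continuous_imp_continuous[OF core_uniformly_continuous]]
    measurable_cong_sets[OF sets_mu refl] by blast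

lemma integrable_core:
  assumes "f \<in> \<A>"
  shows "integrable \<mu> f"
proof -
  obtain b where "\<And>x. norm (f x) \<le> b"
    using core_bounded[OF assms] by (auto simp: bounded_iff)
  then show ?thesis
    using core_measurable[OF assms] by (intro integrable_const_bound[of _ b]) auto
qed

lemma core_poly: "f \<in> \<A> \<Longrightarrow> (\<lambda>x. poly p (f x)) \<in> \<A>"
  by (rule core_smooth[OF _ smooth_real_poly])

lemma core_scale: "f \<in> \<A> \<Longrightarrow> (\<lambda>x. c * f x) \<in> \<A>"
  by (intro core_mult core_const)

lemma core_power2: "f \<in> \<A> \<Longrightarrow> (\<lambda>x. (f x)\<^sup>2) \<in> \<A>"
  by (simp add: power2_eq_square core_mult)

lemma generator_measurable: "f \<in> \<A> \<Longrightarrow> generator \<mu> P f \<in> borel_measurable \<mu>"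
proof -
  assume "f \<in> \<A>"
  then have "has_generator \<mu> P f (generator \<mu> P f)"
    using core_domain unfolding generator_domain_def generator_def by (auto simp: some_eq_ex)
  then show ?thesis
    by (simp add: has_generator_def square_integrable_def)
qed

lemma carre_du_champ_measurable:
  "f \<in> \<A> \<Longrightarrow> g \<in> \<A> \<Longrightarrow> carre_du_champ \<mu> P f g \<in> borel_measurable \<mu>"
  unfolding carre_du_champ_def[abs_def]
  using core_mult core_measurable generator_measurable by measurable

lemma carre_du_champ_comp:
  assumes "f \<in> \<A>" "smooth_real \<Psi>"
  shows "AE x in \<mu>. carre_du_champ \<mu> P (\<lambda>y. \<Psi> (f y)) (\<lambda>y. \<Psi> (f y)) x =
           (deriv \<Psi> (f x))\<^sup>2 * carre_du_champ \<mu> P f f x"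
  using chain_rule[OF assms(1,1,2,2)] by (simp add: power2_eq_square)

lemma carre_du_champ_poly:
  assumes "f \<in> \<A>"
  shows "AE x in \<mu>. carre_du_champ \<mu> P (\<lambda>y. poly p (f y)) (\<lambda>y. poly p (f y)) x =
           (poly (pderiv p) (f x))\<^sup>2 * carre_du_champ \<mu> P f f x"
  using carre_du_champ_comp[OF assms smooth_real_poly[of p]] by (simp add: DERIV_imp_deriv[OF poly_DERIV])

text \<open>Multiplication by c is composition with the polynomial \<open>[:0, c:]\<close>, so the
  chain rule supplies the factor c^2 almost everywhere. This avoids comparing the versions chosen by
  \<open>generator\<close>.\<close>

lemma weighted_energy_scale:
  assumes f: "f \<in> \<A>" and \<omega>: "\<omega> \<in> borel_measurable \<mu>"
  shows "weighted_energy \<mu> P \<omega> (\<lambda>x. c * f x) = ereal (c\<^sup>2) * weighted_energy \<mu> P \<omega> f"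
proof -
  note [measurable] = carre_du_champ_measurable[OF f f] \<omega>
  have "AE x in \<mu>. ennreal (carre_du_champ \<mu> P (\<lambda>x. c * f x) (\<lambda>x. c * f x) x * \<omega> x) =
      ennreal (c\<^sup>2) * ennreal (carre_du_champ \<mu> P f f x * \<omega> x)"
    using carre_du_champ_poly[OF f, of "[:0, c:]"]
    by eventually_elim (simp add: mult.commute pderiv_pCons mult.left_commute flip: ennreal_mult')
  then have "(\<integral>\<^sup>+x. ennreal (carre_du_champ \<mu> P (\<lambda>x. c * f x) (\<lambda>x. c * f x) x * \<omega> x) \<partial>\<mu>) =
      (\<integral>\<^sup>+x. ennreal (c\<^sup>2) * ennreal (carre_du_champ \<mu> P f f x * \<omega> x) \<partial>\<mu>)"
    by (rule nn_integral_cong_AE)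
  also have "\<dots> = ennreal (c\<^sup>2) * (\<integral>\<^sup>+x. ennreal (carre_du_champ \<mu> P f f x * \<omega> x) \<partial>\<mu>)"
    by (rule nn_integral_cmult) measurable
  finally show ?thesis
    by (simp add: weighted_energy_def times_ennreal.rep_eq)
qed

text \<open>Written as the constant polynomial \<open>[:c:]\<close> of itself, the function gets the
  factor 0 from the chain rule.\<close>

lemma weighted_energy_const:
  assumes \<omega>: "\<omega> \<in> borel_measurable \<mu>"
  shows "weighted_energy \<mu> P \<omega> (\<lambda>_. c) = 0"
proof -
  have "AE x in \<mu>. ennreal (carre_du_champ \<mu> P (\<lambda>_. c) (\<lambda>_. c) x * \<omega> x) = 0"
    using carre_du_champ_poly[OF core_const, of "[:c:]"]
    by eventually_elim simp
  then have "(\<integral>\<^sup>+x. ennreal (carre_du_champ \<mu> P (\<lambda>_. c) (\<lambda>_. c) x * \<omega> x) \<partial>\<mu>) = (\<integral>\<^sup>+x. 0 \<partial>\<mu>)"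
    by (rule nn_integral_cong_AE)
  then show ?thesis
    by (simp add: weighted_energy_def zero_ennreal.rep_eq)
qed

text \<open>Both sides are homogeneous of degree two, so f may be divided by its L2 norm. If that
  norm is 0, the left side vanishes and \<open>0 \<le> b\<close> makes the right side
  nonnegative.\<close>

lemma super_Poincare_normalized:
  assumes \<omega>: "\<omega> \<in> borel_measurable \<mu>" and f: "f \<in> \<A>" and "0 < s" and "0 \<le> b"
    and normalized: "\<And>g. g \<in> \<A> \<Longrightarrow> (\<integral>x. (g x)\<^sup>2 \<partial>\<mu>) = 1 \<Longrightarrow>
      1 \<le> ereal s * weighted_energy \<mu> P \<omega> g + ereal (b * (\<integral>x. \<bar>g x\<bar> \<partial>\<mu>)\<^sup>2)"
  shows "ereal (\<integral>x. (f x)\<^sup>2 \<partial>\<mu>)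
    \<le> ereal s * weighted_energy \<mu> P \<omega> f + ereal (b * (\<integral>x. \<bar>f x\<bar> \<partial>\<mu>)\<^sup>2)"
proof -
  define N where "N = (\<integral>x. (f x)\<^sup>2 \<partial>\<mu>)"
  have "0 \<le> N" by (simp add: N_def)
  show ?thesis
  proof (cases "N = 0")
    case True
    have "0 \<le> ereal s * weighted_energy \<mu> P \<omega> f + ereal (b * (\<integral>x. \<bar>f x\<bar> \<partial>\<mu>)\<^sup>2)"
      using assms by (intro add_nonneg_nonneg mult_nonneg_nonneg) (auto simp: weighted_energy_nonneg)
    then show ?thesis using True by (simp add: N_def flip: zero_ereal_def)
  next
    case False
    define c where "c = 1 / sqrt N"
    have N: "0 < N" "c\<^sup>2 = 1 / N" "0 \<le> c"
      using False \<open>0 \<le> N\<close> by (auto simp: c_def power_divide)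
    have "(\<integral>x. (c * f x)\<^sup>2 \<partial>\<mu>) = 1"
      using N False by (simp add: power_mult_distrib flip: N_def)
    from normalized[OF core_scale[OF f] this]
    have "1 \<le> ereal s * (ereal (1 / N) * weighted_energy \<mu> P \<omega> f)
        + ereal (b * (1 / N * (\<integral>x. \<bar>f x\<bar> \<partial>\<mu>)\<^sup>2))"
      using N by (simp add: weighted_energy_scale[OF f \<omega>] abs_mult power_mult_distrib)
    then show ?thesis
      using N weighted_energy_nonneg[of \<mu> P \<omega> f] \<open>0 < s\<close>
      by (cases "weighted_energy \<mu> P \<omega> f")
        (auto simp: one_ereal_def field_simps simp flip: N_def)
  qed
qed

end

section \<open>From F-Sobolev to super Poincare\<close>

lemma gen_inverse_nonneg:
  assumes "filterlim F at_top at_top"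
  shows "0 \<le> gen_inverse F s"
proof -
  have "eventually (\<lambda>r. s \<le> F r \<and> 0 \<le> r) at_top"
    using assms eventually_ge_at_top by (auto simp: filterlim_at_top intro: eventually_conj)
  then have "{r. 0 \<le> r \<and> s \<le> F r} \<noteq> {}"
    by (auto simp: eventually_at_top_linorder)
  then show ?thesis
    unfolding gen_inverse_def by (rule cInf_greatest) simp
qed

text \<open>The infimum lies below r, so some r' < r already has K \<le> F r'; as K > a,
  monotonicity above the level a carries this on to r.\<close>

lemma le_beyond_gen_inverse:
  assumes mono: "mono_on {0<..} (\<lambda>r. max a (F r))" and lim: "filterlim F at_top at_top"
    and K: "a < K" "F 0 < K" and r: "gen_inverse F K < r"
  shows "K \<le> F r"
proof -
  have "eventually (\<lambda>r. K \<le> F r \<and> 0 \<le> r) at_top"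
    using lim eventually_ge_at_top by (auto simp: filterlim_at_top intro: eventually_conj)
  then have ne: "{r. 0 \<le> r \<and> K \<le> F r} \<noteq> {}"
    by (auto simp: eventually_at_top_linorder)
  then obtain r' where "0 \<le> r'" "K \<le> F r'" "r' < r"
    using cInf_lessD[OF ne] r unfolding gen_inverse_def by auto
  \<comment> \<open>\<open>F 0 < K\<close> excludes r' = 0, a point outside the range of
    monotonicity.\<close>
  moreover from this have "0 < r'" using K by (cases "r' = 0") auto
  ultimately have "max a (F r') \<le> max a (F r)"
    by (intro mono_onD[OF mono]) auto
  then show ?thesis using \<open>K \<le> F r'\<close> K by auto
qed

text \<open>Boundedness near 0 gives A, compactness gives B from 1 up to a point n beyond which F is
  nonnegative. Adding A + B r thus makes r F(r) nonnegative.\<close>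

lemma mult_lower_bound:
  fixes F :: "real \<Rightarrow> real"
  assumes cont: "continuous_on {0<..} F" and bdd: "bdd_above ((\<lambda>r. \<bar>r * F r\<bar>) ` {0<..<1})"
    and lim: "filterlim F at_top at_top"
  obtains A B where "0 \<le> A" "0 \<le> B" "\<And>r. 0 \<le> r \<Longrightarrow> - A - B * r \<le> r * F r"
proof -
  obtain A where A: "\<And>r. 0 < r \<Longrightarrow> r < 1 \<Longrightarrow> \<bar>r * F r\<bar> \<le> A"
    using bdd unfolding bdd_above_def by fastforce
  obtain n where n: "\<And>r. n \<le> r \<Longrightarrow> 0 \<le> F r"
    using lim by (auto simp: filterlim_at_top eventually_at_top_linorder)
  have "compact (F ` {1..n})"
    by (intro compact_continuous_image continuous_on_subset[OF cont]) auto
  then obtain B where B: "\<And>r. 1 \<le> r \<Longrightarrow> r \<le> n \<Longrightarrow> \<bar>F r\<bar> \<le> B"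
    using compact_imp_bounded[of "F ` {1..n}"] unfolding bounded_iff by fastforce
  show ?thesis
  proof (rule that[of "\<bar>A\<bar>" "\<bar>B\<bar>"])
    fix r :: real assume "0 \<le> r"
    then consider "r = 0" | "0 < r" "r < 1" | "1 \<le> r" by linarith
    then show "- \<bar>A\<bar> - \<bar>B\<bar> * r \<le> r * F r"
    proof cases
      case 2
      then have "0 \<le> \<bar>B\<bar> * r" by simp
      then show ?thesis using A[OF 2] by linarith
    next
      case 3
      have "- \<bar>B\<bar> \<le> F r" using B[of r] n[of r] 3 by (cases "r \<le> n") auto
      then have "r * (- \<bar>B\<bar>) \<le> r * F r" using 3 by (intro mult_left_mono) auto
      then show ?thesis by (simp add: mult.commute)
    qed auto
  qed auto
qed

text \<open>Continuity is available on the open half-line only. The indicator changes nothing for r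
  \<ge> 0, since r F(r) is 0 at r = 0 whatever \<open>F 0\<close> is.\<close>

lemma mult_bounded_measurable:
  fixes F :: "real \<Rightarrow> real"
  assumes cont: "continuous_on {0<..} F" and bdd: "bdd_above ((\<lambda>r. \<bar>r * F r\<bar>) ` {0<..<1})"
  shows "(\<lambda>r. indicator {0<..} r * (r * F r)) \<in> borel_measurable borel"
    and "\<exists>D. \<forall>r. 0 \<le> r \<longrightarrow> r \<le> b \<longrightarrow> \<bar>r * F r\<bar> \<le> D"
proof -
  show "(\<lambda>r. indicator {0<..} r * (r * F r)) \<in> borel_measurable borel"
    using borel_measurable_continuous_on_indicator[of "{0<..}" "\<lambda>r. r * F r"] cont
    by (simp add: continuous_on_mult)
  obtain A where A: "\<And>r. 0 < r \<Longrightarrow> r < 1 \<Longrightarrow> \<bar>r * F r\<bar> \<le> A"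
    using bdd unfolding bdd_above_def by fastforce
  have "compact ((\<lambda>r. r * F r) ` {1..b})"
    by (intro compact_continuous_image continuous_intros continuous_on_subset[OF cont]) auto
  then obtain B where B: "\<And>r. 1 \<le> r \<Longrightarrow> r \<le> b \<Longrightarrow> \<bar>r * F r\<bar> \<le> B"
    using compact_imp_bounded[of "(\<lambda>r. r * F r) ` {1..b}"] unfolding bounded_iff by fastforce
  have "\<bar>r * F r\<bar> \<le> \<bar>A\<bar> + \<bar>B\<bar>" if "0 \<le> r" "r \<le> b" for r
    using that A[of r] B[of r] by (cases "r = 0"; cases "r < 1") auto
  then show "\<exists>D. \<forall>r. 0 \<le> r \<longrightarrow> r \<le> b \<longrightarrow> \<bar>r * F r\<bar> \<le> D" by blast
qed

context symmetric_diffusion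
begin

lemma integrable_F_Sobolev:
  fixes F :: "real \<Rightarrow> real"
  assumes cont: "continuous_on {0<..} F" and bdd: "bdd_above ((\<lambda>r. \<bar>r * F r\<bar>) ` {0<..<1})"
    and f: "f \<in> \<A>"
  shows "integrable \<mu> (\<lambda>x. (f x)\<^sup>2 * F ((f x)\<^sup>2))"
proof -
  obtain b where b: "\<And>x. norm ((f x)\<^sup>2) \<le> b"
    using core_bounded[OF core_power2[OF f]] by (auto simp: bounded_iff)
  obtain D where D: "\<And>r. 0 \<le> r \<Longrightarrow> r \<le> b \<Longrightarrow> \<bar>r * F r\<bar> \<le> D"
    using mult_bounded_measurable(2)[OF cont bdd] by metis
  note [measurable] = core_measurable[OF f] mult_bounded_measurable(1)[OF cont bdd]
  have "(\<lambda>x. indicator {0<..} ((f x)\<^sup>2) * ((f x)\<^sup>2 * F ((f x)\<^sup>2))) \<in> borel_measurable \<mu>"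
    by (rule measurable_compose[OF _ mult_bounded_measurable(1)[OF cont bdd]]) measurable
  also have "(\<lambda>x. indicator {0<..} ((f x)\<^sup>2) * ((f x)\<^sup>2 * F ((f x)\<^sup>2))) =
      (\<lambda>x. (f x)\<^sup>2 * F ((f x)\<^sup>2))"
    by (auto simp: fun_eq_iff indicator_def)
  finally show ?thesis
    by (rule integrable_const_bound[of _ D, rotated])
      (use b D in \<open>auto simp: abs_mult intro!: AE_I2\<close>)
qed

lemma F_Sobolev_imp_super_Poincare:
  fixes F :: "real \<Rightarrow> real"
  assumes \<omega>: "\<omega> \<in> borel_measurable \<mu>"
    and cont: "continuous_on {0<..} F" and incr: "increasing_at_high_levels F"
    and bdd: "bdd_above ((\<lambda>r. \<bar>r * F r\<bar>) ` {0<..<1})"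
    and lim: "filterlim F at_top at_top"
    and Sob: "defective_weighted_F_Sobolev \<mu> P \<A> \<omega> (\<lambda>r. ereal (F r)) C\<^sub>1 C\<^sub>2"
  shows "\<exists>c\<^sub>1>0. \<exists>c\<^sub>2>0.
    weighted_super_Poincare \<mu> P \<A> \<omega> (\<lambda>s. c\<^sub>1 * gen_inverse F (c\<^sub>2 * (1 + 1 / s)))"
proof -
  obtain a where a: "mono_on {0<..} (\<lambda>r. max a (F r))"
    using incr by (auto simp: increasing_at_high_levels_def)
  obtain A B where AB: "0 \<le> A" "0 \<le> B" "\<And>r. 0 \<le> r \<Longrightarrow> - A - B * r \<le> r * F r"
    using mult_lower_bound[OF cont bdd lim] by blast
  \<comment> \<open>Each summand serves one demand on K = c (1 + 1 / s): the first reduces the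
    energy term to s / 4 times the energy, the second reduces the defect to 1 / 2, and the rest put
    K above a, \<open>F 0\<close> and 0.\<close>
  define c where "c = 4 * \<bar>C\<^sub>1\<bar> + 2 * (\<bar>C\<^sub>2\<bar> + A + B) + \<bar>a\<bar> + \<bar>F 0\<bar> + 1"
  have "0 < c" using AB by (simp add: c_def)
  have "ereal (\<integral>x. (f x)\<^sup>2 \<partial>\<mu>) \<le> ereal s * weighted_energy \<mu> P \<omega> f
      + ereal (4 * gen_inverse F (c * (1 + 1 / s)) * (\<integral>x. \<bar>f x\<bar> \<partial>\<mu>)\<^sup>2)"
    if f: "f \<in> \<A>" and s: "0 < s" for f s
  proof (rule super_Poincare_normalized[OF \<omega> f])
    define K where "K = c * (1 + 1 / s)"
    define R where "R = gen_inverse F K"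
    have "0 \<le> R" unfolding R_def by (rule gen_inverse_nonneg[OF lim])
    show "0 < s" "0 \<le> 4 * gen_inverse F (c * (1 + 1 / s))"
      using s \<open>0 \<le> R\<close> by (auto simp: R_def K_def)
    have "c \<le> K" "c \<le> K * s"
      using s \<open>0 < c\<close> by (auto simp: K_def field_simps)
    moreover have "4 * \<bar>C\<^sub>1\<bar> \<le> c" "2 * (\<bar>C\<^sub>2\<bar> + A + B) \<le> c" "a < c" "F 0 < c"
      using AB by (auto simp: c_def)
    ultimately have K: "4 * \<bar>C\<^sub>1\<bar> \<le> K * s" "2 * (\<bar>C\<^sub>2\<bar> + A + B) \<le> K" "a < K" "F 0 < K" "0 < K"
      using \<open>0 < c\<close> by linarith+
    have FR: "K \<le> F r" if "R < r" for r
      using le_beyond_gen_inverse[OF a lim K(3,4)] that by (simp add: R_def)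
    fix g assume g: "g \<in> \<A>" and norm: "(\<integral>x. (g x)\<^sup>2 \<partial>\<mu>) = 1"
    define m where "m = (\<integral>x. \<bar>g x\<bar> \<partial>\<mu>)"
    define I where "I = (\<integral>x. (g x)\<^sup>2 * F ((g x)\<^sup>2) \<partial>\<mu>)"
    note int = integrable_F_Sobolev[OF cont bdd g] integrable_core[OF core_power2[OF g]]
      integrable_abs[OF integrable_core[OF g]]
    have I: "ereal I \<le> ereal C\<^sub>1 * weighted_energy \<mu> P \<omega> g + ereal C\<^sub>2"
      using Sob[unfolded defective_weighted_F_Sobolev_def, rule_format, OF g norm]
        ext_integral_real[OF int(1)] by (simp add: I_def)
    have "(g x)\<^sup>2 \<le> sqrt R * \<bar>g x\<bar> + ((g x)\<^sup>2 * F ((g x)\<^sup>2) + A + B * (g x)\<^sup>2) / K" for x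
    proof (cases "(g x)\<^sup>2 \<le> R")
      case True
      then have "\<bar>g x\<bar> \<le> sqrt R" by (metis real_sqrt_abs real_sqrt_le_iff)
      then have "\<bar>g x\<bar> * \<bar>g x\<bar> \<le> sqrt R * \<bar>g x\<bar>" by (intro mult_right_mono) auto
      moreover have "0 \<le> ((g x)\<^sup>2 * F ((g x)\<^sup>2) + A + B * (g x)\<^sup>2) / K"
        using AB(3)[of "(g x)\<^sup>2"] K by (intro divide_nonneg_pos) auto
      ultimately show ?thesis by (simp add: power2_eq_square)
    next
      case False
      then have "(g x)\<^sup>2 * K \<le> (g x)\<^sup>2 * F ((g x)\<^sup>2)" by (intro mult_left_mono FR) auto
      moreover have "0 \<le> B * (g x)\<^sup>2" using AB by simp
      ultimately have "(g x)\<^sup>2 \<le> ((g x)\<^sup>2 * F ((g x)\<^sup>2) + A + B * (g x)\<^sup>2) / K"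
        using AB(1) \<open>0 < K\<close> by (simp add: pos_le_divide_eq del: mult_le_cancel_left)
      then show ?thesis using \<open>0 \<le> R\<close> by (simp add: add_increasing)
    qed
    then have "(\<integral>x. (g x)\<^sup>2 \<partial>\<mu>) \<le>
        (\<integral>x. sqrt R * \<bar>g x\<bar> + ((g x)\<^sup>2 * F ((g x)\<^sup>2) + A + B * (g x)\<^sup>2) / K \<partial>\<mu>)"
      using int by (intro integral_mono) auto
    also have "\<dots> = sqrt R * m + (I + A + B) / K"
      using int norm by (simp add: m_def I_def prob_space)
    finally have 1: "1 \<le> sqrt R * m + (I + A + B) / K" by (simp add: norm)
    show "1 \<le> ereal s * weighted_energy \<mu> P \<omega> g
        + ereal (4 * gen_inverse F (c * (1 + 1 / s)) * (\<integral>x. \<bar>g x\<bar> \<partial>\<mu>)\<^sup>2)"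
    proof (cases "weighted_energy \<mu> P \<omega> g")
      case (real e)
      have "0 \<le> e" using weighted_energy_nonneg[of \<mu> P \<omega> g] real by simp
      have "I \<le> C\<^sub>1 * e + C\<^sub>2" using I real by simp
      also have "\<dots> \<le> \<bar>C\<^sub>1\<bar> * e + \<bar>C\<^sub>2\<bar>" using \<open>0 \<le> e\<close> by (intro add_mono mult_right_mono) auto
      finally have "(I + A + B) / K \<le> \<bar>C\<^sub>1\<bar> / K * e + (\<bar>C\<^sub>2\<bar> + A + B) / K"
        using K by (simp add: divide_right_mono flip: add_divide_distrib)
      also have "\<dots> \<le> s / 4 * e + 1 / 2"
        using K \<open>0 \<le> e\<close> by (intro add_mono mult_right_mono) (auto simp: field_simps)
      finally have "1 / 2 \<le> sqrt R * m + s / 4 * e" using 1 by linarith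
      \<comment> \<open>This leaves 1 / 4 on the left; multiplying by 4 explains both the
        coefficient s / 4 above and the constant 4 in the conclusion.\<close>
      moreover have "sqrt R * m \<le> 1 / 4 + (sqrt R * m)\<^sup>2"
        using zero_le_power2[of "sqrt R * m - 1 / 2"] by (simp add: power2_eq_square algebra_simps)
      moreover have "(sqrt R * m)\<^sup>2 = R * m\<^sup>2"
        using \<open>0 \<le> R\<close> by (simp add: power_mult_distrib)
      ultimately have "1 \<le> s * e + 4 * R * m\<^sup>2" by linarith
      then show ?thesis using real by (simp add: R_def K_def m_def one_ereal_def)
    next
      case PInf
      then show ?thesis using s by simp
    next
      case MInf
      then show ?thesis using weighted_energy_nonneg[of \<mu> P \<omega> g] by simp
    qed
  qed
  then show ?thesis
    using \<open>0 < c\<close> unfolding weighted_super_Poincare_def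
    by (intro exI[of _ 4] conjI exI[of _ c]) auto
qed

end

section \<open>From super Poincare to F-Sobolev\<close>

lemma ext_integral_le_nn_integral: "ext_integral M g \<le> enn2ereal (\<integral>\<^sup>+x. e2ennreal (g x) \<partial>M)"
  unfolding ext_integral_def
  by (rule ereal_diff_le_self) simp

text \<open>Nonnegativity of \<beta> makes every term of the supremum nondecreasing in t.\<close>

lemma xi_mono:
  assumes "\<And>r. 0 < r \<Longrightarrow> 0 \<le> \<beta> r" "0 < s" "s \<le> t"
  shows "xi \<beta> s \<le> xi \<beta> t"
  unfolding xi_def
proof (rule SUP_mono)
  fix r :: real assume r: "r \<in> {0<..}"
  then have "\<beta> r / (r * t) \<le> \<beta> r / (r * s)"
    using assms by (intro divide_left_mono) auto
  then show "\<exists>r'\<in>{0<..}. ereal (1 / r - \<beta> r / (r * s)) \<le> ereal (1 / r' - \<beta> r' / (r' * t))"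
    using r by (intro bexI[of _ r]) auto
qed

text \<open>The factor r cancels the prefactor 1 / r, and discarding the subtracted 1 and the
  negative part only enlarges the value. What remains is a nonnegative integral, fit for
  Tonelli.\<close>

lemma mult_F_of_beta_le:
  assumes "0 \<le> r"
  shows "e2ennreal (ereal r * F_of_beta \<beta> \<epsilon> 1 1 r) \<le>
    (\<integral>\<^sup>+\<tau>. e2ennreal (xi \<beta> (\<epsilon> * \<tau>)) * indicator {0<..r} \<tau> \<partial>lborel)"
proof (cases "r = 0")
  case True
  then show ?thesis by (simp flip: zero_ereal_def)
next
  case False
  define J where "J = ext_integral (restrict_space lborel {0<..r}) (\<lambda>t. xi \<beta> (\<epsilon> * t))"
  have "ereal r * F_of_beta \<beta> \<epsilon> 1 1 r \<le> J"
    using assms False unfolding F_of_beta_def J_def[symmetric]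
    by (cases J) (auto simp: field_simps)
  also have "\<dots> \<le> enn2ereal (\<integral>\<^sup>+\<tau>. e2ennreal (xi \<beta> (\<epsilon> * \<tau>)) \<partial>restrict_space lborel {0<..r})"
    unfolding J_def by (rule ext_integral_le_nn_integral)
  finally show ?thesis
    by (auto dest!: e2ennreal_mono simp: nn_integral_restrict_space)
qed

text \<open>Since (2 y / t)^2 = (4 / y^2) (y^2 / t)^2, the bound 4 of
  \<open>deriv_flat_exp_le\<close> gives 64 = 4 * 4^2. For t \<ge> y^2 the cut-off is in its flat
  region.\<close>

lemma deriv_flat_level_bound:
  assumes "0 < t"
  shows "(deriv flat_exp (y\<^sup>2 / t - 1))\<^sup>2 * (2 * y / t)\<^sup>2 \<le> indicator {0<..<y\<^sup>2} t * (64 / y\<^sup>2)"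
proof (cases "t < y\<^sup>2")
  case False
  then have "\<not> 0 < y\<^sup>2 / t - 1" using assms by (simp add: field_simps)
  then show ?thesis by (simp add: deriv_flat_exp)
next
  case True
  define d where "d = deriv flat_exp (y\<^sup>2 / t - 1)"
  have "0 \<le> d" "d * (y\<^sup>2 / t) \<le> 4"
    using deriv_flat_exp_le[of "y\<^sup>2 / t - 1"] True assms by (auto simp: d_def field_simps)
  then have "(d * (y\<^sup>2 / t))\<^sup>2 \<le> 4\<^sup>2" using assms by (intro power_mono) auto
  moreover have "d\<^sup>2 * (2 * y / t)\<^sup>2 = 4 / y\<^sup>2 * (d * (y\<^sup>2 / t))\<^sup>2"
    using True assms by (simp add: field_simps power2_eq_square)
  ultimately have "d\<^sup>2 * (2 * y / t)\<^sup>2 \<le> 4 / y\<^sup>2 * 4\<^sup>2"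
    by (metis mult_left_mono zero_le_divide_iff zero_le_numeral zero_le_power2)
  then show ?thesis using True assms by (simp add: d_def)
qed

context symmetric_diffusion
begin

lemma core_flat_level: "f \<in> \<A> \<Longrightarrow> (\<lambda>x. flat_exp ((f x)\<^sup>2 / t - 1)) \<in> \<A>"
  using core_smooth[OF core_poly[of f "[:-1, 0, 1 / t:]"] smooth_real_flat_poly[of 1]]
  by (simp add: power2_eq_square)

lemma carre_du_champ_flat_level:
  assumes f: "f \<in> \<A>" and "0 < t" and \<omega>: "\<And>x. 0 \<le> \<omega> x"
  defines "h \<equiv> \<lambda>x. flat_exp ((f x)\<^sup>2 / t - 1)"
  shows "AE x in \<mu>. ennreal (carre_du_champ \<mu> P h h x * \<omega> x) \<le>
    indicator {0<..<(f x)\<^sup>2} t * ennreal (64 / (f x)\<^sup>2) * ennreal (carre_du_champ \<mu> P f f x * \<omega> x)"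
proof -
  \<comment> \<open>The cut-off is \<open>flat_exp\<close> after the polynomial y^2 / t - 1; the
    chain rule is applied once to each layer.\<close>
  let ?p = "[:-1, 0, 1 / t:]"
  have p: "poly ?p y = y\<^sup>2 / t - 1" "poly (pderiv ?p) y = 2 * y / t" for y
    by (auto simp: pderiv_pCons power2_eq_square)
  have "AE x in \<mu>. carre_du_champ \<mu> P h h x =
      (deriv flat_exp ((f x)\<^sup>2 / t - 1))\<^sup>2 * (2 * f x / t)\<^sup>2 * carre_du_champ \<mu> P f f x"
    using carre_du_champ_comp[OF core_poly[OF f, of ?p] smooth_real_flat_poly[of 1]]
      carre_du_champ_poly[OF f, of ?p]
    unfolding p h_def by eventually_elim simp
  then show ?thesis
  proof eventually_elim
    case (elim x)
    define c where "c = (deriv flat_exp ((f x)\<^sup>2 / t - 1))\<^sup>2 * (2 * f x / t)\<^sup>2"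
    have "ennreal (carre_du_champ \<mu> P h h x * \<omega> x) = ennreal c * ennreal (carre_du_champ \<mu> P f f x * \<omega> x)"
      unfolding elim by (simp add: c_def mult.assoc flip: ennreal_mult')
    also have "\<dots> \<le> ennreal (indicator {0<..<(f x)\<^sup>2} t * (64 / (f x)\<^sup>2)) *
        ennreal (carre_du_champ \<mu> P f f x * \<omega> x)"
      unfolding c_def using deriv_flat_level_bound[OF \<open>0 < t\<close>]
      by (intro mult_right_mono ennreal_leI) auto
    also have "ennreal (indicator {0<..<(f x)\<^sup>2} t * (64 / (f x)\<^sup>2)) =
        indicator {0<..<(f x)\<^sup>2} t * ennreal (64 / (f x)\<^sup>2)"
      by (simp add: indicator_def)
    finally show ?case .
  qed
qed

text \<open>On the support of the flat level function \<open>f\<^sup>2 > t\<close>, so by Cauchy--Schwarz its mean is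
  small compared with its second moment.\<close>

lemma flat_level_mean:
  assumes f: "f \<in> \<A>" and norm: "(\<integral>x. (f x)\<^sup>2 \<partial>\<mu>) = 1" and "0 < t"
  defines "h \<equiv> \<lambda>x. flat_exp ((f x)\<^sup>2 / t - 1)"
  shows "(\<integral>x. \<bar>h x\<bar> \<partial>\<mu>)\<^sup>2 \<le> (\<integral>x. (h x)\<^sup>2 \<partial>\<mu>) / t"
proof -
  define m where "m = (\<integral>x. \<bar>h x\<bar> \<partial>\<mu>)"
  define V where "V = (\<integral>x. (h x)\<^sup>2 \<partial>\<mu>)"
  have h: "h \<in> \<A>" unfolding h_def by (rule core_flat_level[OF f])
  note int = integrable_core[OF h] integrable_core[OF core_power2[OF h]] integrable_core[OF core_power2[OF f]]
  have "0 \<le> m" "0 \<le> V" by (simp_all add: m_def V_def)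
  show ?thesis
  proof (cases "m = 0")
    case True
    then show ?thesis using \<open>0 \<le> V\<close> \<open>0 < t\<close> by (simp add: m_def V_def)
  next
    case False
    with \<open>0 \<le> m\<close> have "0 < m" by simp
    \<comment> \<open>Cauchy-Schwarz in the form of a weighted arithmetic-geometric mean inequality,
      with the mean m itself as weight: integrating and using that f has norm 1 gives 2 m \<le> V /
      (m t) + m.\<close>
    have "2 * \<bar>h x\<bar> \<le> (h x)\<^sup>2 / (m * t) + m * (f x)\<^sup>2" for x
    proof (cases "t < (f x)\<^sup>2")
      case True
      have "2 * \<bar>h x\<bar> \<le> (h x)\<^sup>2 / (m * t) + m * t"
        using zero_le_power2[of "\<bar>h x\<bar> - m * t"] \<open>0 < m\<close> \<open>0 < t\<close>
        by (simp add: field_simps power2_eq_square)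
      also have "\<dots> \<le> (h x)\<^sup>2 / (m * t) + m * (f x)\<^sup>2"
        using True \<open>0 < m\<close> by simp
      finally show ?thesis .
    next
      case False
      then have "h x = 0" using \<open>0 < t\<close> by (auto simp: h_def flat_poly_def field_simps)
      then show ?thesis using \<open>0 < m\<close> by simp
    qed
    then have "(\<integral>x. 2 * \<bar>h x\<bar> \<partial>\<mu>) \<le> (\<integral>x. (h x)\<^sup>2 / (m * t) + m * (f x)\<^sup>2 \<partial>\<mu>)"
      using int by (intro integral_mono) auto
    then have "2 * m \<le> V / (m * t) + m"
      using int norm by (simp add: m_def V_def)
    then have "m\<^sup>2 \<le> V / t"
      using \<open>0 < m\<close> \<open>0 < t\<close> by (simp add: field_simps power2_eq_square)
    then show ?thesis by (simp add: m_def V_def)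
  qed
qed

text \<open>For h of energy e the super Poincare inequality reads V \<le> r e + \<beta>(r) V / t
  once its mean is bounded. Dividing by r V and taking the supremum over r produces
  \<open>xi\<close>.\<close>

lemma xi_flat_level_le:
  assumes sP: "weighted_super_Poincare \<mu> P \<A> \<omega> \<beta>"
    and \<beta>: "\<And>r. 0 < r \<Longrightarrow> 0 \<le> \<beta> r"
    and f: "f \<in> \<A>" and norm: "(\<integral>x. (f x)\<^sup>2 \<partial>\<mu>) = 1" and "0 < t"
  defines "h \<equiv> \<lambda>x. flat_exp ((f x)\<^sup>2 / t - 1)"
  shows "e2ennreal (xi \<beta> t) * (\<integral>\<^sup>+x. ennreal ((h x)\<^sup>2) \<partial>\<mu>) \<le>
    (\<integral>\<^sup>+x. ennreal (carre_du_champ \<mu> P h h x * \<omega> x) \<partial>\<mu>)"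
proof -
  define V where "V = (\<integral>x. (h x)\<^sup>2 \<partial>\<mu>)"
  have h: "h \<in> \<A>" unfolding h_def by (rule core_flat_level[OF f])
  have "0 \<le> V" by (simp add: V_def)
  have V: "(\<integral>\<^sup>+x. ennreal ((h x)\<^sup>2) \<partial>\<mu>) = ennreal V"
    unfolding V_def by (intro nn_integral_eq_integral integrable_core core_power2 h) auto
  show ?thesis
  \<comment> \<open>\<open>xi \<beta> t\<close> may be infinite; for V = 0 the product is still 0 in
    \<open>ennreal\<close>.\<close>
  proof (cases "V = 0 \<or> (\<integral>\<^sup>+x. ennreal (carre_du_champ \<mu> P h h x * \<omega> x) \<partial>\<mu>) = \<infinity>")
    case True
    then show ?thesis using V by auto
  next
    case False
    then obtain e where e: "0 \<le> e"
        "(\<integral>\<^sup>+x. ennreal (carre_du_champ \<mu> P h h x * \<omega> x) \<partial>\<mu>) = ennreal e"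
      by (metis ennreal_cases infinity_ennreal_def)
    have "0 < V" using False \<open>0 \<le> V\<close> by auto
    have "1 / r - \<beta> r / (r * t) \<le> e / V" if "0 < r" for r
    proof -
      have "V \<le> r * e + \<beta> r * (\<integral>x. \<bar>h x\<bar> \<partial>\<mu>)\<^sup>2"
        using sP h that e unfolding weighted_super_Poincare_def weighted_energy_def V_def by force
      also have "\<dots> \<le> r * e + \<beta> r * (V / t)"
        using flat_level_mean[OF f norm \<open>0 < t\<close>] \<beta>[OF that]
        by (intro add_left_mono mult_left_mono) (auto simp: h_def V_def)
      finally show ?thesis
        using \<open>0 < V\<close> that \<open>0 < t\<close> by (simp add: field_simps)
    qed
    then have "xi \<beta> t \<le> ereal (e / V)"
      unfolding xi_def by (intro SUP_least) simp
    then have "e2ennreal (xi \<beta> t) * ennreal V \<le> ennreal (e / V) * ennreal V"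
      by (intro mult_right_mono) (auto dest: e2ennreal_mono)
    also have "\<dots> = ennreal e"
      using \<open>0 < V\<close> e by (simp flip: ennreal_mult)
    finally show ?thesis using V e by simp
  qed
qed

text \<open>The inequality is tested on the constant 1, which has no energy. This is the source of
  the nonnegativity of \<beta> used for \<open>xi\<close>.\<close>

lemma super_Poincare_rate_ge_1:
  assumes sP: "weighted_super_Poincare \<mu> P \<A> \<omega> \<beta>" and \<omega>: "\<omega> \<in> borel_measurable \<mu>" and "0 < s"
  shows "1 \<le> \<beta> s"
  using sP core_const[of 1] \<open>0 < s\<close> weighted_energy_const[OF \<omega>, of 1]
  unfolding weighted_super_Poincare_def by (fastforce simp: prob_space)

text \<open>In the constant, 64 comes from the gradient of the cut-off, 1 / \<epsilon> from the
  substitution t = \<epsilon> \<tau>, and the squared value of \<open>flat_exp\<close> from the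
  lower bound of the cut-off.\<close>

lemma super_Poincare_imp_F_Sobolev:
  assumes \<omega>: "\<omega> \<in> borel_measurable \<mu>" "\<And>x. 0 \<le> \<omega> x"
    and sP: "weighted_super_Poincare \<mu> P \<A> \<omega> \<beta>" and \<epsilon>: "0 < \<epsilon>" "\<epsilon> < 1"
  shows "defective_weighted_F_Sobolev \<mu> P \<A> \<omega> (F_of_beta \<beta> \<epsilon> 1 1)
    (64 / (\<epsilon> * (flat_exp (1 / \<epsilon> - 1))\<^sup>2)) 0"
  unfolding defective_weighted_F_Sobolev_def
proof (intro ballI impI)
  fix f assume f: "f \<in> \<A>" and norm: "(\<integral>x. (f x)\<^sup>2 \<partial>\<mu>) = 1"
  \<comment> \<open>The value at f^2 = \<tau> of the cut-off at level \<epsilon> \<tau>; it is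
    positive because \<epsilon> < 1.\<close>
  define k where "k = flat_exp (1 / \<epsilon> - 1)"
  have "0 < k" unfolding k_def using \<epsilon> by (intro flat_exp_bounds) simp
  define \<gamma> where "\<gamma> x = ennreal (carre_du_champ \<mu> P f f x * \<omega> x)" for x
  \<comment> \<open>The extension by 0 keeps \<open>w\<close> monotone on the whole line, hence
    measurable.\<close>
  define w where "w \<tau> = (if 0 < \<tau> then e2ennreal (xi \<beta> (\<epsilon> * \<tau>)) else 0)" for \<tau>
  define h where "h t x = flat_exp ((f x)\<^sup>2 / t - 1)" for t x
  \<comment> \<open>A majorant of the energy density of the cut-off at level \<epsilon> \<tau>,
    explicit in \<tau> and jointly measurable.\<close>
  define G where "G \<tau> x = indicator {0<..<(f x)\<^sup>2} (\<epsilon> * \<tau>) * ennreal (64 / (f x)\<^sup>2) * \<gamma> x" for \<tau> x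
  have \<beta>: "0 \<le> \<beta> r" if "0 < r" for r
    using super_Poincare_rate_ge_1[OF sP \<omega>(1) that] by simp
  have "mono w"
    using \<epsilon> unfolding w_def by (auto intro!: monoI e2ennreal_mono xi_mono \<beta>)
  note [measurable] = borel_measurable_mono_linorder[OF this] core_measurable[OF f]
    carre_du_champ_measurable[OF f f] \<omega>(1)
  have [measurable]: "\<gamma> \<in> borel_measurable \<mu>" unfolding \<gamma>_def[abs_def] by measurable
  interpret pair_sigma_finite lborel \<mu> ..
  have [measurable]: "Measurable.pred (lborel \<Otimes>\<^sub>M \<mu>) (\<lambda>p. fst p \<in> {..(f (snd p))\<^sup>2})"
    "Measurable.pred (lborel \<Otimes>\<^sub>M \<mu>) (\<lambda>p. \<epsilon> * fst p \<in> {0<..<(f (snd p))\<^sup>2})"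
    unfolding atMost_iff greaterThanLessThan_iff by measurable
  have w_measurable: "(\<lambda>(\<tau>, x). w \<tau> * indicator {..(f x)\<^sup>2} \<tau>) \<in> borel_measurable (lborel \<Otimes>\<^sub>M \<mu>)"
    unfolding split_beta' by measurable
  have G_measurable: "(\<lambda>(\<tau>, x). G \<tau> x) \<in> borel_measurable (lborel \<Otimes>\<^sub>M \<mu>)"
    unfolding split_beta' G_def by measurable
  have 1: "(\<integral>\<^sup>+x. w \<tau> * indicator {..(f x)\<^sup>2} \<tau> \<partial>\<mu>) \<le> ennreal (1 / k\<^sup>2) * (\<integral>\<^sup>+x. G \<tau> x \<partial>\<mu>)" for \<tau>
  proof (cases "0 < \<tau>")
    case False
    then show ?thesis by (simp add: w_def)
  next
    case True
    define t where "t = \<epsilon> * \<tau>"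
    have "0 < t" using True \<epsilon> by (simp add: t_def)
    have [measurable]: "h t \<in> borel_measurable \<mu>"
      using core_measurable[OF core_flat_level[OF f]] by (simp add: h_def[abs_def])
    \<comment> \<open>Where f^2 \<ge> \<tau>, monotonicity of \<open>flat_exp\<close> keeps the
      cut-off at least k.\<close>
    have "indicator {..(f x)\<^sup>2} \<tau> \<le> ennreal (1 / k\<^sup>2) * ennreal ((h t x)\<^sup>2)" for x
    proof (cases "\<tau> \<le> (f x)\<^sup>2")
      case le: True
      then have "1 / \<epsilon> - 1 \<le> (f x)\<^sup>2 / t - 1"
        using True \<epsilon> by (simp add: t_def field_simps)
      then have "k \<le> h t x" unfolding k_def h_def by (rule flat_exp_mono)
      then have "k\<^sup>2 \<le> (h t x)\<^sup>2" using \<open>0 < k\<close> by (intro power_mono) auto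
      then show ?thesis using \<open>0 < k\<close> le by (simp flip: ennreal_mult ennreal_1)
    qed simp
    then have "(\<integral>\<^sup>+x. w \<tau> * indicator {..(f x)\<^sup>2} \<tau> \<partial>\<mu>) \<le>
        (\<integral>\<^sup>+x. w \<tau> * (ennreal (1 / k\<^sup>2) * ennreal ((h t x)\<^sup>2)) \<partial>\<mu>)"
      by (intro nn_integral_mono mult_left_mono) auto
    also have "\<dots> = ennreal (1 / k\<^sup>2) * (w \<tau> * (\<integral>\<^sup>+x. ennreal ((h t x)\<^sup>2) \<partial>\<mu>))"
      by (simp add: nn_integral_cmult mult.left_commute)
    also have "w \<tau> * (\<integral>\<^sup>+x. ennreal ((h t x)\<^sup>2) \<partial>\<mu>) \<le>
        (\<integral>\<^sup>+x. ennreal (carre_du_champ \<mu> P (h t) (h t) x * \<omega> x) \<partial>\<mu>)"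
      using xi_flat_level_le[OF sP \<beta> f norm \<open>0 < t\<close>] True
      by (simp add: w_def t_def h_def[abs_def])
    also have "\<dots> \<le> (\<integral>\<^sup>+x. G \<tau> x \<partial>\<mu>)"
      using carre_du_champ_flat_level[OF f \<open>0 < t\<close>, of \<omega>] \<omega>
      by (intro nn_integral_mono_AE) (simp add: G_def h_def[abs_def] t_def \<gamma>_def)
    finally show ?thesis by (simp add: mult_left_mono)
  qed
  have 2: "(\<integral>\<^sup>+\<tau>. G \<tau> x \<partial>lborel) \<le> ennreal (64 / \<epsilon>) * \<gamma> x" for x
  proof -
    have "(\<integral>\<^sup>+\<tau>. G \<tau> x \<partial>lborel) =
        (\<integral>\<^sup>+\<tau>. ennreal (64 / (f x)\<^sup>2) * \<gamma> x * indicator {0<..<(f x)\<^sup>2 / \<epsilon>} \<tau> \<partial>lborel)"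
      using \<epsilon> by (intro nn_integral_cong)
        (auto simp: G_def indicator_def field_simps zero_less_mult_iff)
    also have "\<dots> = ennreal (64 / (f x)\<^sup>2) * \<gamma> x * ennreal ((f x)\<^sup>2 / \<epsilon>)"
      using \<epsilon> by (simp add: nn_integral_cmult_indicator)
    also have "\<dots> = ennreal (64 / (f x)\<^sup>2 * ((f x)\<^sup>2 / \<epsilon>)) * \<gamma> x"
      using \<epsilon> by (subst ennreal_mult) (simp_all add: mult_ac)
    \<comment> \<open>Where f x = 0 division by 0 makes the left side 0, hence an inequality;
      elsewhere f^2 cancels.\<close>
    also have "\<dots> \<le> ennreal (64 / \<epsilon>) * \<gamma> x"
      using \<epsilon> by (intro mult_right_mono ennreal_leI) auto
    finally show ?thesis .
  qed
  have "(\<integral>\<^sup>+x. e2ennreal (ereal ((f x)\<^sup>2) * F_of_beta \<beta> \<epsilon> 1 1 ((f x)\<^sup>2)) \<partial>\<mu>) \<le>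
      (\<integral>\<^sup>+x. \<integral>\<^sup>+\<tau>. w \<tau> * indicator {..(f x)\<^sup>2} \<tau> \<partial>lborel \<partial>\<mu>)"
  proof (intro nn_integral_mono order_trans[OF mult_F_of_beta_le])
    fix x
    show "e2ennreal (xi \<beta> (\<epsilon> * \<tau>)) * indicator {0<..(f x)\<^sup>2} \<tau> \<le> w \<tau> * indicator {..(f x)\<^sup>2} \<tau>" for \<tau>
      by (simp add: w_def indicator_def)
  qed simp
  also have "\<dots> = (\<integral>\<^sup>+\<tau>. \<integral>\<^sup>+x. w \<tau> * indicator {..(f x)\<^sup>2} \<tau> \<partial>\<mu> \<partial>lborel)"
    by (rule Fubini'[OF w_measurable])
  also have "\<dots> \<le> (\<integral>\<^sup>+\<tau>. ennreal (1 / k\<^sup>2) * (\<integral>\<^sup>+x. G \<tau> x \<partial>\<mu>) \<partial>lborel)"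
    by (intro nn_integral_mono 1)
  also have "\<dots> = ennreal (1 / k\<^sup>2) * (\<integral>\<^sup>+\<tau>. \<integral>\<^sup>+x. G \<tau> x \<partial>\<mu> \<partial>lborel)"
    using sigma_finite_measure.borel_measurable_nn_integral_fst[OF
        prob_space_imp_sigma_finite[OF prob_space_axioms] G_measurable]
    by (intro nn_integral_cmult) simp
  also have "(\<integral>\<^sup>+\<tau>. \<integral>\<^sup>+x. G \<tau> x \<partial>\<mu> \<partial>lborel) = (\<integral>\<^sup>+x. \<integral>\<^sup>+\<tau>. G \<tau> x \<partial>lborel \<partial>\<mu>)"
    by (rule Fubini'[OF G_measurable, symmetric])
  also have "ennreal (1 / k\<^sup>2) * \<dots> \<le> ennreal (1 / k\<^sup>2) * (\<integral>\<^sup>+x. ennreal (64 / \<epsilon>) * \<gamma> x \<partial>\<mu>)"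
    by (intro mult_left_mono nn_integral_mono 2) auto
  also have "\<dots> = ennreal (1 / k\<^sup>2) * ennreal (64 / \<epsilon>) * (\<integral>\<^sup>+x. \<gamma> x \<partial>\<mu>)"
    by (simp add: nn_integral_cmult mult.assoc)
  also have "\<dots> = ennreal (64 / (\<epsilon> * k\<^sup>2)) * (\<integral>\<^sup>+x. \<gamma> x \<partial>\<mu>)"
    using \<epsilon> by (subst ennreal_mult[symmetric]) (simp_all add: mult.commute)
  finally have "enn2ereal (\<integral>\<^sup>+x. e2ennreal (ereal ((f x)\<^sup>2) * F_of_beta \<beta> \<epsilon> 1 1 ((f x)\<^sup>2)) \<partial>\<mu>) \<le>
      ereal (64 / (\<epsilon> * k\<^sup>2)) * weighted_energy \<mu> P \<omega> f"
    using \<epsilon> by (simp add: less_eq_ennreal.rep_eq times_ennreal.rep_eq weighted_energy_def \<gamma>_def)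
  then show "ext_integral \<mu> (\<lambda>x. ereal ((f x)\<^sup>2) * F_of_beta \<beta> \<epsilon> 1 1 ((f x)\<^sup>2)) \<le>
      ereal (64 / (\<epsilon> * (flat_exp (1 / \<epsilon> - 1))\<^sup>2)) * weighted_energy \<mu> P \<omega> f + ereal 0"
    using order_trans[OF ext_integral_le_nn_integral] by (simp add: k_def)
qed

end

theorem proposition2p6:
  fixes \<mu> :: "'a::polish_space measure"
    and P :: "real \<Rightarrow> 'a \<Rightarrow> 'a measure"
    and \<A> :: "('a \<Rightarrow> real) set"
    and \<omega> :: "'a \<Rightarrow> real"
  assumes "symmetric_diffusion \<mu> P \<A>"
    and "\<omega> \<in> borel_measurable borel"
    and "\<forall>x. 1 \<le> \<omega> x"
  shows
    "(\<forall>(F :: real \<Rightarrow> real) C\<^sub>1 C\<^sub>2.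
        continuous_on {0<..} F \<and>
        increasing_at_high_levels F \<and>
        bdd_above ((\<lambda>r. \<bar>r * F r\<bar>) ` {0<..<1}) \<and>
        F 1 = 0 \<and>
        filterlim F at_top at_top \<and>
        defective_weighted_F_Sobolev \<mu> P \<A> \<omega> (\<lambda>r. ereal (F r)) C\<^sub>1 C\<^sub>2 \<longrightarrow>
        (\<exists>c\<^sub>1>0. \<exists>c\<^sub>2>0.
           weighted_super_Poincare \<mu> P \<A> \<omega> (\<lambda>s. c\<^sub>1 * gen_inverse F (c\<^sub>2 * (1 + 1 / s)))))
     \<and>
     (\<forall>\<beta> :: real \<Rightarrow> real.
        antimono_on {0<..} \<beta> \<and> weighted_super_Poincare \<mu> P \<A> \<omega> \<beta> \<longrightarrow>
        (\<forall>\<epsilon>. 0 < \<epsilon> \<and> \<epsilon> < 1 \<longrightarrow>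
           (\<exists>c\<^sub>1>0. \<exists>c\<^sub>2>0. \<exists>C\<^sub>1 C\<^sub>2.
              defective_weighted_F_Sobolev \<mu> P \<A> \<omega> (F_of_beta \<beta> \<epsilon> c\<^sub>1 c\<^sub>2) C\<^sub>1 C\<^sub>2)))"
proof -
  interpret symmetric_diffusion \<mu> P \<A> by fact
  have \<omega>: "\<omega> \<in> borel_measurable \<mu>" "\<And>x. 0 \<le> \<omega> x"
    using assms(2,3) measurable_cong_sets[OF sets_mu refl] by (auto intro: order_trans[of 0 1])
  show ?thesis
  proof (intro conjI allI impI)
    fix F :: "real \<Rightarrow> real" and C\<^sub>1 C\<^sub>2
    assume *: "continuous_on {0<..} F \<and> increasing_at_high_levels F \<and>
        bdd_above ((\<lambda>r. \<bar>r * F r\<bar>) ` {0<..<1}) \<and> F 1 = 0 \<and> filterlim F at_top at_top \<and>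
        defective_weighted_F_Sobolev \<mu> P \<A> \<omega> (\<lambda>r. ereal (F r)) C\<^sub>1 C\<^sub>2"
    show "\<exists>c\<^sub>1>0. \<exists>c\<^sub>2>0.
        weighted_super_Poincare \<mu> P \<A> \<omega> (\<lambda>s. c\<^sub>1 * gen_inverse F (c\<^sub>2 * (1 + 1 / s)))"
      using * by (intro F_Sobolev_imp_super_Poincare[OF \<omega>(1), where C\<^sub>1 = C\<^sub>1 and C\<^sub>2 = C\<^sub>2]) simp_all
  next
    fix \<beta> :: "real \<Rightarrow> real" and \<epsilon> :: real
    assume "antimono_on {0<..} \<beta> \<and> weighted_super_Poincare \<mu> P \<A> \<omega> \<beta>" "0 < \<epsilon> \<and> \<epsilon> < 1"
    then have "defective_weighted_F_Sobolev \<mu> P \<A> \<omega> (F_of_beta \<beta> \<epsilon> 1 1)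
        (64 / (\<epsilon> * (flat_exp (1 / \<epsilon> - 1))\<^sup>2)) 0"
      by (intro super_Poincare_imp_F_Sobolev \<omega>) simp_all
    \<comment> \<open>Both constants of F are 1 for every \<epsilon>; the dependence on \<epsilon>
      sits in the energy constant, and the defect is 0.\<close>
    then show "\<exists>c\<^sub>1>0. \<exists>c\<^sub>2>0. \<exists>C\<^sub>1 C\<^sub>2.
        defective_weighted_F_Sobolev \<mu> P \<A> \<omega> (F_of_beta \<beta> \<epsilon> c\<^sub>1 c\<^sub>2) C\<^sub>1 C\<^sub>2"
      by (intro exI[of _ 1] conjI exI) simp_all
  qed
qed

end
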